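(* Let $E$ be a real normed vector space, $\Omega\subset E$ a nonempty open set, $\hat{x}\in\Omega$, and let $(h_n)_{n\in\mathbb{N}}$ be a sequence of functions $h_n:\Omega\to\mathbb{R}$ satisfying property $(H)$ at $\hat{x}$, with $h_\infty$ the function given by property $(H)$. Suppose moreover that the sequence $(h_n)$ is invex at $\hat{x}$. Then one of the following alternatives is true: A1) $\big\{ (x,t)\in \Omega\times [0,1]: \sup_{n\in \mathbb{N}} \big(h_n(x) - (1-t)h_n(\hat{x})\big) <0 \big\}\neq \emptyset$; A2) there exists a sequence of real numbers $(\alpha_{\infty},\alpha_0,\alpha_1,\ldots)$ such that: (i) $\alpha_{\infty}\geq 0$, $\alpha_n\geq 0$ for all $n\in \mathbb{N}$ and $\alpha_{\infty}+\sum_{n\geq 0} \alpha_n=1$, (ii) $\alpha_{\infty} h_{\infty}(\hat{x}) + \sum_{n\geq 0} \alpha_{n} h_n(\hat{x}) \geq 0$, (iii) the function $\alpha_{\infty} h_{\infty}+\sum_{n\geq 0} \alpha_{n} h_n$ has a global minimum on $\Omega$ at $\hat{x}$.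
   Context: $\mathbb{N}=\{0,1,2,\ldots\}$. For $f$ real-valued near $x$, the upper Dini derivative at $x$ in direction $u\in E$ is $D^+ f(x)(u) :=\limsup_{t\to 0^+} \frac{f(x+tu)-f(x)}{t}$ (and $D^+f(x)(0)=0$). A function $p:E\to\mathbb{R}$ is sublinear if $p(x+y)\le p(x)+p(y)$ and $p(\lambda x)=\lambda p(x)$ for all $x,y\in E$ and real $\lambda\ge 0$. Let $B(\hat{x},r)$ be the open ball of center $\hat{x}$ and radius $r\in(0,+\infty]$ (with $B(\hat x,+\infty)=E$). For a real-valued Lipschitz function $h$ on $B(\hat{x},r)\cap\Omega$ put $\|h\|_{\hat{x},r}=\sup_{x\ne y\in B(\hat{x},r)\cap\Omega}\frac{|h(x)-h(y)|}{\|x-y\|}$. Property $(H)$ at $\hat{x}$: there is $r\in(0,+\infty]$ such that every $h_n$ is Lipschitz on $B(\hat{x},r)\cap\Omega$, and: (i) $D^+h_n(\hat{x})$ is sublinear for all $n\in\mathbb{N}$; (ii) there exists a function $h_\infty:\Omega\to\mathbb{R}$, Lipschitz on $B(\hat{x},r)\cap\Omega$, such that $h_\infty(\hat{x})=\lim_{n\to\infty}h_n(\hat{x})$ and $\|h_n-h_\infty\|_{\hat{x},r}\to 0$ as $n\to\infty$. The sequence $(h_n)$ is invex at $\hat{x}$ if there exists a map $\mu_{\hat{x}}:E\to E$ (the same for all $n$) such that $D^+ h_n(\hat{x})(\mu_{\hat{x}}(x)) \leq h_n(x)-h_n(\hat{x})$ for all $x\in \Omega$ and all $n\in \mathbb{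N}$.
   Formalization: In (iii), at points of Ω outside B(x̂,r), where (H) leaves h_∞ arbitrary and the literal claim can fail, h_∞(x) is replaced by max(h_∞(x), liminf h_n(x)) and the series may equal +∞; nothing changes if Ω⊂B(x̂,r) or h_n→h_∞ pointwise on Ω. *)

theory Defs
  imports "HOL-Analysis.Analysis"
begin

definition dini_upper :: "('a::real_normed_vector \<Rightarrow> real) \<Rightarrow> 'a \<Rightarrow> 'a \<Rightarrow> ereal" where
  "dini_upper f x u = Limsup (at_right 0) (\<lambda>t. ereal ((f (x + t *\<^sub>R u) - f x) / t))"

lemma dini_upper_zero: "dini_upper f x 0 = 0"
  by (simp add: dini_upper_def Limsup_const zero_ereal_def)

definition sublinear :: "('a::real_vector \<Rightarrow> real) \<Rightarrow> bool" where
  "sublinear p \<longleftrightarrow>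
     (\<forall>x y. p (x + y) \<le> p x + p y) \<and> (\<forall>c x. 0 \<le> c \<longrightarrow> p (c *\<^sub>R x) = c * p x)"

text \<open>The radius may be infinite, in which case the ball is the whole space.\<close>

definition ext_ball :: "'a::metric_space \<Rightarrow> ereal \<Rightarrow> 'a set" where
  "ext_ball x r = {y. ereal (dist x y) < r}"

text \<open>The supremum is taken in \<^typ>\<open>ennreal\<close>, so that it is \<open>0\<close> over the empty set
  (trivial space).\<close>

definition lip_norm :: "'a::real_normed_vector set \<Rightarrow> ('a \<Rightarrow> real) \<Rightarrow> ennreal" where
  "lip_norm S f =
     (SUP (x, y) \<in> {(x, y). x \<in> S \<and> y \<in> S \<and> x \<noteq> y}. ennreal (\<bar>f x - f y\<bar> / norm (x - y)))"

text \<open>Property \<open>(H)\<close> at \<open>z\<close>, with the witnesses \<open>r\<close> and \<open>hinf\<close> as parameters. Functions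
  on \<open>\<Omega>\<close> are represented by total functions whose values outside \<open>\<Omega>\<close> are irrelevant
  (\<open>\<Omega>\<close> is open, so the Dini derivatives at \<open>z \<in> \<Omega>\<close> only see values in \<open>\<Omega>\<close>).
  Sublinear functions are real-valued, so condition \<open>(i)\<close> includes finiteness of the Dini
  derivative.\<close>

definition property_H ::
  "'a::real_normed_vector set \<Rightarrow> (nat \<Rightarrow> 'a \<Rightarrow> real) \<Rightarrow> 'a \<Rightarrow> ereal \<Rightarrow> ('a \<Rightarrow> real) \<Rightarrow> bool" where
  "property_H \<Omega> h z r hinf \<longleftrightarrow>
     0 < r \<and>
     (\<forall>n. \<exists>L. L-lipschitz_on (ext_ball z r \<inter> \<Omega>) (h n)) \<and>
     (\<forall>n. \<exists>p. sublinear p \<and> (\<forall>u. dini_upper (h n) z u = ereal (p u))) \<and>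
     (\<exists>L. L-lipschitz_on (ext_ball z r \<inter> \<Omega>) hinf) \<and>
     (\<lambda>n. h n z) \<longlonglongrightarrow> hinf z \<and>
     (\<lambda>n. lip_norm (ext_ball z r \<inter> \<Omega>) (\<lambda>x. h n x - hinf x)) \<longlonglongrightarrow> 0"

definition invex_seq ::
  "'a::real_normed_vector set \<Rightarrow> (nat \<Rightarrow> 'a \<Rightarrow> real) \<Rightarrow> 'a \<Rightarrow> bool" where
  "invex_seq \<Omega> h z \<longleftrightarrow>
     (\<exists>\<mu> :: 'a \<Rightarrow> 'a. \<forall>x\<in>\<Omega>. \<forall>n. dini_upper (h n) z (\<mu> x) \<le> ereal (h n x - h n z))"

text \<open>Property \<open>(H)\<close> determines \<open>hinf\<close> only on \<open>B = ext_ball z r\<close>; off \<open>B\<close> its values are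
  arbitrary, and a global minimum of a combination involving \<open>hinf\<close> cannot be expected for
  all of them: take \<open>h n x = x\<^sup>2 - 1 / (n + 1)\<close> on the reals, \<open>z = 0\<close>, \<open>r = 1\<close>, and \<open>hinf x = x\<^sup>2\<close>
  on \<open>B\<close>, \<open>hinf x = - 1\<close> off \<open>B\<close>. Nonnegativity of the combination at \<open>0\<close> forces weight \<open>1\<close> on
  \<open>hinf\<close>. Hence, off \<open>B\<close> only, \<open>hinf\<close> is raised to the lower limit of the sequence where it
  lies below it. Nothing changes where \<open>hinf\<close> is the pointwise limit.\<close>

definition limit_fun ::
  "'a set \<Rightarrow> (nat \<Rightarrow> 'a \<Rightarrow> real) \<Rightarrow> ('a \<Rightarrow> real) \<Rightarrow> 'a \<Rightarrow> ereal" where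
  "limit_fun B h hinf x =
     (if x \<in> B then ereal (hinf x)
      else max (ereal (hinf x)) (liminf (\<lambda>n. ereal (h n x))))"

lemma limit_fun_eq:
  assumes "x \<in> B \<or> liminf (\<lambda>n. ereal (h n x)) \<le> ereal (hinf x)"
  shows "limit_fun B h hinf x = ereal (hinf x)"
  using assms by (auto simp: limit_fun_def max_absorb1)

lemma limit_fun_eq_of_tendsto:
  assumes "(\<lambda>n. h n x) \<longlonglongrightarrow> hinf x"
  shows "limit_fun B h hinf x = ereal (hinf x)"
proof -
  have "liminf (\<lambda>n. ereal (h n x)) = ereal (hinf x)"
    using assms by (intro lim_imp_Liminf) (auto intro: tendsto_ereal)
  then show ?thesis by (simp add: limit_fun_def)
qed

text \<open>The series is taken in \<^typ>\<open>ereal\<close>: at points off the ball the sequence \<open>h n x\<close> may be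
  unbounded above, and then the series may diverge to \<open>\<infinity>\<close>. Where \<open>h n x\<close> is bounded in \<open>n\<close>,
  in particular on the ball, it is the ordinary real series if the weights are summable.\<close>

definition weighted_fun ::
  "real \<Rightarrow> (nat \<Rightarrow> real) \<Rightarrow> ('a \<Rightarrow> ereal) \<Rightarrow> (nat \<Rightarrow> 'a \<Rightarrow> real) \<Rightarrow> 'a \<Rightarrow> ereal" where
  "weighted_fun ainf a g h x = ereal ainf * g x + (\<Sum>n. ereal (a n * h n x))"

lemma weighted_fun_real:
  assumes "g x = ereal y" and "summable (\<lambda>n. a n * h n x)"
  shows "weighted_fun ainf a g h x = ereal (ainf * y + (\<Sum>n. a n * h n x))"
  using assms by (simp add: weighted_fun_def suminf_ereal' sums_unique[symmetric] summable_sums)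

end

theory Submission
  imports Defs
begin

text \<open>Let \<open>p n\<close> be the Dini derivative of \<open>h n\<close> at \<open>z\<close>. Since \<open>h n - hinf\<close> tends to \<open>0\<close> in the
  Lipschitz seminorm, \<open>p n\<close> converges pointwise and the differential estimates at \<open>z\<close> are uniform
  in \<open>n\<close>. If the first alternative fails, every sequence \<open>\<tau> * h n z + p n u\<close> with \<open>\<tau> \<ge> 0\<close> has a
  nonnegative supremum, as otherwise a small step in direction \<open>u\<close> would yield a point of the
  first alternative. By sublinearity these convergent sequences generate a convex cone that avoids
  the negative sequences, so Hahn-Banach provides a positive functional on the space of convergent
  sequences that is nonnegative on the cone. Such a functional is given by weights on
  \<open>\<nat> \<union> {\<infinity>}\<close>; taking \<open>u = 0\<close> gives nonnegativity at \<open>z\<close>, and \<open>\<tau> = 0\<close> together with invexity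
  gives the global minimum.\<close>

section \<open>Hahn-Banach for sublinear functions\<close>

lemma sublinear_add_le: "sublinear p \<Longrightarrow> p (x + y) \<le> p x + p y"
  by (simp add: sublinear_def)

lemma sublinear_scaleR: "sublinear p \<Longrightarrow> 0 \<le> c \<Longrightarrow> p (c *\<^sub>R x) = c * p x"
  by (simp add: sublinear_def)

lemma sublinear_0: "sublinear p \<Longrightarrow> p 0 = 0"
  using sublinear_scaleR[of p 0 0] by simp

lemma sublinear_neg_le: "sublinear p \<Longrightarrow> - p (- x) \<le> p x"
  using sublinear_add_le[of p x "- x"] by (simp add: sublinear_0)

text \<open>Using \<open>scale\<close> with \<open>inverse c\<close> at \<open>c *\<^sub>R x\<close>
  gives the reverse inequality, so one-sided homogeneity suffices. The factors \<open>2\<close> and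
  \<open>1/2\<close> force \<open>p 0 = 0\<close>.\<close>

lemma sublinearI_le:
  assumes add: "\<And>x y. p (x + y) \<le> p x + p y"
    and scale: "\<And>c x. 0 < c \<Longrightarrow> p (c *\<^sub>R x) \<le> c * p x"
  shows "sublinear p"
proof -
  have "p 0 = 0" using scale[of 2 0] scale[of "1/2" 0] by simp
  moreover have "p (c *\<^sub>R x) = c * p x" if c: "0 < c" for c x
  proof (rule antisym)
    have "p x = p (inverse c *\<^sub>R c *\<^sub>R x)" using c by simp
    also have "\<dots> \<le> inverse c * p (c *\<^sub>R x)" using c by (intro scale) simp
    finally show "c * p x \<le> p (c *\<^sub>R x)" using c by (simp add: field_simps)
  qed (rule scale[OF c])
  ultimately show ?thesis
    unfolding sublinear_def using add by (metis less_eq_real_def mult_zero_left scaleR_zero_left)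
qed

text \<open>An infimum only needs some member below each required bound, so directedness up to
  domination is enough, and \<open>k\<close> may depend on the points. This covers the infimum along
  a ray, the infimum of a chain and the separating gauge.\<close>

lemma sublinear_INF:
  fixes g :: "'i \<Rightarrow> 'v::real_vector \<Rightarrow> real"
  assumes ne: "I \<noteq> {}"
    and bdd: "\<And>x. bdd_below ((\<lambda>i. g i x) ` I)"
    and add: "\<And>i j x y. i \<in> I \<Longrightarrow> j \<in> I \<Longrightarrow> \<exists>k\<in>I. g k (x + y) \<le> g i x + g j y"
    and scale: "\<And>i c x. i \<in> I \<Longrightarrow> 0 < c \<Longrightarrow> \<exists>k\<in>I. g k (c *\<^sub>R x) \<le> c * g i x"
  shows "sublinear (\<lambda>x. INF i\<in>I. g i x)"
proof (rule sublinearI_le)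
  let ?p = "\<lambda>x. INF i\<in>I. g i x"
  fix x y
  have "?p (x + y) - g i x \<le> g j y" if i: "i \<in> I" and j: "j \<in> I" for i j
  proof -
    obtain k where "k \<in> I" "g k (x + y) \<le> g i x + g j y" using add[OF i j] by blast
    then show ?thesis using cINF_lower2[OF bdd, of k "x + y"] by force
  qed
  then have "?p (x + y) - g i x \<le> ?p y" if "i \<in> I" for i
    using that by (intro cINF_greatest[OF ne])
  then have "?p (x + y) - ?p y \<le> ?p x"
    by (intro cINF_greatest[OF ne]) force
  then show "?p (x + y) \<le> ?p x + ?p y" by simp
next
  let ?p = "\<lambda>x. INF i\<in>I. g i x"
  fix c :: real and x assume c: "0 < c"
  have "?p (c *\<^sub>R x) / c \<le> g i x" if i: "i \<in> I" for i
  proof -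
    obtain k where "k \<in> I" "g k (c *\<^sub>R x) \<le> c * g i x" using scale[OF i c] by blast
    then show ?thesis using cINF_lower2[OF bdd, of k "c *\<^sub>R x"] c by (force simp: field_simps)
  qed
  then have "?p (c *\<^sub>R x) / c \<le> ?p x" by (intro cINF_greatest[OF ne])
  then show "?p (c *\<^sub>R x) \<le> c * ?p x" using c by (simp add: field_simps)
qed

text \<open>Lowering \<open>p\<close> along the ray of \<open>y\<close>, by the infimum of
  \<open>p (x + t *\<^sub>R y) - t * p y\<close> over \<open>t \<ge> 0\<close>, keeps it sublinear,
  so minimality leaves it unchanged. At \<open>- y\<close> the choice \<open>t = 1\<close> gives
  \<open>p (- y) \<le> - p y\<close>, and an odd sublinear function is linear.\<close>

lemma linear_of_minimal_sublinear:
  assumes p: "sublinear p"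
    and min: "\<And>p'. sublinear p' \<Longrightarrow> (\<And>x. p' x \<le> p x) \<Longrightarrow> p' = p"
  shows "linear p"
proof -
  have neg: "p (- y) = - p y" for y
  proof -
    let ?g = "\<lambda>t x. p (x + t *\<^sub>R y) - t * p y"
    let ?p = "\<lambda>x. INF t\<in>{0..}. ?g t x"
    have bdd: "bdd_below ((\<lambda>t. ?g t x) ` {0..})" for x
    proof (rule bdd_belowI2)
      fix t :: real assume "t \<in> {0..}"
      then have "t * p y = p ((x + t *\<^sub>R y) + (- x))" by (simp add: sublinear_scaleR[OF p])
      also have "\<dots> \<le> p (x + t *\<^sub>R y) + p (- x)" by (rule sublinear_add_le[OF p])
      finally show "- p (- x) \<le> ?g t x" by simp
    qed
    have "sublinear ?p"
    proof (rule sublinear_INF[OF _ bdd])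
      fix s t x x' assume "s \<in> {0::real..}" "t \<in> {0::real..}"
      then show "\<exists>k\<in>{0..}. ?g k (x + x') \<le> ?g s x + ?g t x'"
        using sublinear_add_le[OF p, of "x + s *\<^sub>R y" "x' + t *\<^sub>R y"]
        by (intro bexI[of _ "s + t"]) (auto simp: algebra_simps)
    next
      fix t c :: real and x assume "t \<in> {0..}" "0 < c"
      then show "\<exists>k\<in>{0..}. ?g k (c *\<^sub>R x) \<le> c * ?g t x"
        using sublinear_scaleR[OF p, of c "x + t *\<^sub>R y"]
        by (intro bexI[of _ "c * t"]) (auto simp: algebra_simps)
    qed simp
    moreover have "?p x \<le> p x" for x
      using cINF_lower[OF bdd, of 0 x] by simp
    ultimately have "?p = p" by (rule min)
    from fun_cong[OF this[symmetric], of "- y"] have "p (- y) = ?p (- y)" .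
    also have "\<dots> \<le> - p y"
      using cINF_lower[OF bdd, of 1 "- y"] by (simp add: sublinear_0[OF p])
    finally show ?thesis using sublinear_neg_le[OF p, of "- y"] by simp
  qed
  show ?thesis
  proof (rule linearI)
    fix x y
    show "p (x + y) = p x + p y"
      using sublinear_add_le[OF p, of x y] sublinear_add_le[OF p, of "- x" "- y"]
        neg[of x] neg[of y] neg[of "x + y"] by simp
  next
    fix c :: real and x
    show "p (c *\<^sub>R x) = c *\<^sub>R p x"
    proof (cases "0 \<le> c")
      case False
      then have "p (- ((- c) *\<^sub>R x)) = - (- c * p x)"
        unfolding neg by (subst sublinear_scaleR[OF p]) auto
      then show ?thesis by simp
    qed (simp add: sublinear_scaleR[OF p])
  qed
qed

text \<open>Zorn's lemma for the reversed order gives a minimal sublinear function below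
  \<open>q\<close>, which is then linear. A nonempty chain is bounded below by its pointwise
  infimum.\<close>

lemma sublinear_dominates_linear:
  fixes q :: "'v::real_vector \<Rightarrow> real"
  assumes q: "sublinear q"
  shows "\<exists>L. linear L \<and> (\<forall>x. L x \<le> q x)"
proof -
  define A where "A = {p. sublinear p \<and> p \<le> q}"
  have "\<exists>m\<in>A. \<forall>p\<in>A. p \<le> m \<longrightarrow> p = m"
  proof (rule predicate_Zorn)
    show "partial_order_on A (relation_of (\<lambda>a b. b \<le> a) A)"
      by (intro partial_order_on_relation_ofI) auto
  next
    fix C assume C: "C \<in> Chains (relation_of (\<lambda>a b. b \<le> a) A)"
    then have CA: "C \<subseteq> A" and chain: "\<And>a b. a \<in> C \<Longrightarrow> b \<in> C \<Longrightarrow> a \<le> b \<or> b \<le> a"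
      by (auto simp: Chains_def relation_of_def)
    show "\<exists>u\<in>A. \<forall>a\<in>C. u \<le> a"
    proof (cases "C = {}")
      case True
      then show ?thesis using q by (auto simp: A_def)
    next
      case False
      let ?u = "\<lambda>x. INF p\<in>C. p x"
      \<comment> \<open>The bound \<open>- q (- x) \<le> - p (- x) \<le> p x\<close> is the same for
        all members, so the infimum is finite.\<close>
      have bdd: "bdd_below ((\<lambda>p. p x) ` C)" for x
      proof (rule bdd_belowI2)
        fix p assume "p \<in> C"
        then have "sublinear p" "p (- x) \<le> q (- x)" using CA by (auto simp: A_def le_fun_def)
        then show "- q (- x) \<le> p x" using sublinear_neg_le[of p x] by simp
      qed
      have "sublinear ?u"
      proof (rule sublinear_INF[OF False bdd])
        fix p p' x y assume pp: "p \<in> C" "p' \<in> C"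
        then have sub: "sublinear p" "sublinear p'" using CA by (auto simp: A_def)
        \<comment> \<open>The smaller of the two chain members serves as \<open>k\<close>.\<close>
        show "\<exists>k\<in>C. k (x + y) \<le> p x + p' y"
        proof (cases "p \<le> p'")
          case True
          then have "p y \<le> p' y" by (simp add: le_fun_def)
          then show ?thesis
            using pp sublinear_add_le[OF sub(1), of x y] by (intro bexI[of _ p]) auto
        next
          case False
          then have "p' x \<le> p x" using chain[OF pp] by (blast dest: le_funD)
          then show ?thesis
            using pp sublinear_add_le[OF sub(2), of x y] by (intro bexI[of _ p']) auto
        qed
      next
        fix p c x assume "p \<in> C" "0 < (c::real)"
        then show "\<exists>k\<in>C. k (c *\<^sub>R x) \<le> c * p x"
          using CA by (intro bexI[of _ p]) (auto simp: A_def sublinear_scaleR)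
      qed
      moreover have low: "?u x \<le> p x" if "p \<in> C" for p x
        using cINF_lower[OF bdd that] .
      moreover have "?u \<le> q"
      proof (rule le_funI)
        fix x
        obtain p where "p \<in> C" using False by blast
        then show "?u x \<le> q x" using low[of p x] CA by (auto simp: A_def dest: le_funD intro: order_trans)
      qed
      ultimately show ?thesis
        by (intro bexI[of _ ?u]) (auto simp: A_def le_fun_def)
    qed
  qed
  then obtain m where m: "sublinear m" "m \<le> q"
    and min: "\<And>p. sublinear p \<Longrightarrow> p \<le> q \<Longrightarrow> p \<le> m \<Longrightarrow> p = m"
    by (auto simp: A_def)
  have "linear m"
  proof (rule linear_of_minimal_sublinear[OF m(1)])
    fix p assume p: "sublinear p" "\<And>x. p x \<le> m x"
    then have "p \<le> m" by (simp add: le_funI)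
    with p(1) m(2) show "p = m" by (blast intro: min order_trans)
  qed
  then show ?thesis using m(2) by (auto simp: le_fun_def)
qed

section \<open>Separation in the space of convergent sequences\<close>

lemma convergent_range_bounded:
  fixes f :: "nat \<Rightarrow> real"
  shows "convergent f \<Longrightarrow> bounded (range f)"
  using Bseq_eq_bounded[of f] by (auto dest: convergent_imp_Bseq)

lemma convergent_in_bcontfun:
  fixes f :: "nat \<Rightarrow> real"
  shows "convergent f \<Longrightarrow> f \<in> bcontfun"
  by (simp add: bcontfun_def convergent_range_bounded)

text \<open>The weight \<open>b\<close> at infinity is the mass \<open>1 - (\<Sum>n. a n)\<close> that \<open>L\<close> does not put on unit
  sequences; truncating \<open>f - l\<close> beyond \<open>M\<close> shows that \<open>L\<close> has no other part on convergent
  sequences.\<close>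

lemma linear_le_SUP_weights:
  fixes L :: "(nat \<Rightarrow>\<^sub>C real) \<Rightarrow> real"
  assumes L: "linear L" and le: "\<And>f c. (\<And>n. apply_bcontfun f n \<le> c) \<Longrightarrow> L f \<le> c"
  shows "\<exists>b (a :: nat \<Rightarrow> real). 0 \<le> b \<and> (\<forall>n. 0 \<le> a n) \<and> summable a \<and> b + (\<Sum>n. a n) = 1 \<and>
    (\<forall>f l. (\<lambda>n. apply_bcontfun f n) \<longlonglongrightarrow> l \<longrightarrow>
      summable (\<lambda>n. a n * f n) \<and> L f = b * l + (\<Sum>n. a n * f n))"
proof -
  define e :: "nat \<Rightarrow> nat \<Rightarrow>\<^sub>C real" where "e k = Bcontfun (\<lambda>n. if n = k then 1 else 0)" for k
  define a where "a k = L (e k)" for k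
  have e: "apply_bcontfun (e k) n = (if n = k then 1 else 0)" for k n
  proof -
    have "(\<lambda>n. if n = k then 1 else 0 :: real) \<in> bcontfun"
      by (intro bcontfun_normI[of _ 1]) auto
    then show ?thesis by (simp add: e_def Bcontfun_inverse)
  qed
  \<comment> \<open>Together with \<open>le\<close> this makes \<open>L\<close> positive and fixes
    its value on constant sequences.\<close>
  have ge: "c \<le> L f" if "\<And>n. c \<le> apply_bcontfun f n" for f c
    using le[of "- f" "- c"] that by (simp add: linear_neg[OF L])
  have sum_apply: "apply_bcontfun (\<Sum>k<N. c k *\<^sub>R e k) n = (if n < N then c n else 0)" for c N n
    by (induction N) (auto simp: e less_Suc_eq)
  have L_sum: "L (\<Sum>k<N. c k *\<^sub>R e k) = (\<Sum>k<N. a k * c k)" for c N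
    by (simp add: linear_sum[OF L] linear_cmul[OF L] a_def mult.commute)
  have a0: "0 \<le> a n" for n unfolding a_def by (rule ge) (simp add: e)
  have a1: "(\<Sum>k<N. a k) \<le> 1" for N
    using L_sum[of "\<lambda>_. 1" N] le[of "\<Sum>k<N. 1 *\<^sub>R e k" 1] by (simp add: sum_apply del: scaleR_one)
  have sa: "summable a"
    using a0 a1 by (intro summableI_nonneg_bounded[of a 1]) auto
  define b where "b = 1 - (\<Sum>n. a n)"
  have "0 \<le> b"
    unfolding b_def using suminf_le_const[OF sa a1] by simp
  moreover have "summable (\<lambda>n. a n * f n) \<and> L f = b * l + (\<Sum>n. a n * f n)"
    if lim: "apply_bcontfun f \<longlonglongrightarrow> l" for f l
  proof -
    have "(\<lambda>n. a n * (f n - l)) sums (L f - l)"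
      unfolding sums_def
    proof (rule LIMSEQ_I)
      fix r :: real assume r: "0 < r"
      \<comment> \<open>Half of \<open>r\<close>, because \<open>le\<close> and \<open>ge\<close>
        give weak bounds while the limit needs a strict one.\<close>
      obtain N where N: "\<And>n. n \<ge> N \<Longrightarrow> norm (f n - l) < r / 2"
        using LIMSEQ_D[OF lim, of "r / 2"] r by auto
      show "\<exists>N. \<forall>n\<ge>N. norm ((\<Sum>k<n. a k * (f k - l)) - (L f - l)) < r"
      proof (intro exI allI impI)
        fix M assume M: "M \<ge> N"
        define g where "g = f - const_bcontfun l - (\<Sum>k<M. (f k - l) *\<^sub>R e k)"
        have g: "apply_bcontfun g n = (if n < M then 0 else f n - l)" for n
          by (simp add: g_def sum_apply)
        have "\<bar>g n\<bar> \<le> r / 2" for n using N[of n] M r by (auto simp: g)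
        then have "g n \<le> r / 2" "- (r / 2) \<le> g n" for n using abs_le_iff minus_le_iff by blast+
        then have "L g \<le> r / 2" "- (r / 2) \<le> L g" by (blast intro: le ge)+
        moreover have "L (const_bcontfun l) = l"
          by (intro antisym le ge) auto
        then have "L g = L f - l - (\<Sum>k<M. a k * (f k - l))"
          by (simp add: g_def linear_diff[OF L] L_sum)
        ultimately show "norm ((\<Sum>k<M. a k * (f k - l)) - (L f - l)) < r"
          using r by (simp add: abs_less_iff)
      qed
    qed
    \<comment> \<open>Restoring \<open>l\<close> at every index adds
      \<open>(\<Sum>n. a n) * l\<close>, that is \<open>(1 - b) * l\<close>, which turns
      \<open>L f - l\<close> into \<open>L f - b * l\<close>.\<close>
    then have "(\<lambda>n. a n * (f n - l) + a n * l) sums (L f - l + (\<Sum>n. a n) * l)"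
      by (intro sums_add sums_mult2 summable_sums[OF sa])
    then have "(\<lambda>n. a n * f n) sums (L f - b * l)"
      by (simp add: b_def algebra_simps)
    then show ?thesis by (simp add: sums_iff)
  qed
  ultimately show ?thesis
    using a0 sa by (intro exI[of _ b] exI[of _ a]) (auto simp: b_def)
qed

text \<open>The gauge \<open>q f\<close>, the infimum over \<Phi> of the suprema of
  \<open>f + \<phi>\<close>, is sublinear, and Hahn-Banach gives a linear \<open>L\<close> below it.
  Shrinking members of the cone shows that \<open>L f\<close> is at most any upper bound of
  \<open>f\<close>, so \<open>L\<close> is given by weights; testing at \<open>- \<phi>\<close>
  shows \<open>0 \<le> L \<phi>\<close>. The cone is closed only up to domination, as sums of
  sublinear values require.\<close>

lemma cone_separating_weights:
  fixes \<Phi> :: "(nat \<Rightarrow> real) set"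
  assumes ne: "\<Phi> \<noteq> {}" and conv: "\<And>\<phi>. \<phi> \<in> \<Phi> \<Longrightarrow> convergent \<phi>"
    and add: "\<And>\<phi> \<psi>. \<phi> \<in> \<Phi> \<Longrightarrow> \<psi> \<in> \<Phi> \<Longrightarrow> \<exists>\<theta>\<in>\<Phi>. \<forall>n. \<theta> n \<le> \<phi> n + \<psi> n"
    and scale: "\<And>\<phi> c. \<phi> \<in> \<Phi> \<Longrightarrow> 0 < c \<Longrightarrow> \<exists>\<theta>\<in>\<Phi>. \<forall>n. \<theta> n \<le> c * \<phi> n"
    and nonneg: "\<And>\<phi> c. \<phi> \<in> \<Phi> \<Longrightarrow> (\<And>n. \<phi> n \<le> c) \<Longrightarrow> 0 \<le> c"
  obtains b :: real and a :: "nat \<Rightarrow> real"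
    where "0 \<le> b" "\<And>n. 0 \<le> a n" "summable a" "b + (\<Sum>n. a n) = 1"
      "\<And>\<phi>. \<phi> \<in> \<Phi> \<Longrightarrow> summable (\<lambda>n. a n * \<phi> n) \<and> 0 \<le> b * lim \<phi> + (\<Sum>n. a n * \<phi> n)"
proof -
  define S where "S \<phi> f = (SUP n. apply_bcontfun f n + \<phi> n)" for \<phi> :: "nat \<Rightarrow> real" and f
  define q where "q f = (INF \<phi>\<in>\<Phi>. S \<phi> f)" for f
  have bdd: "bdd_above (range (\<lambda>n. apply_bcontfun f n + \<phi> n))" if "\<phi> \<in> \<Phi>" for f \<phi>
    by (intro bounded_imp_bdd_above bounded_plus_comp bounded_apply_bcontfun
        convergent_range_bounded conv that)
  have S_upper: "apply_bcontfun f n + \<phi> n \<le> S \<phi> f" if "\<phi> \<in> \<Phi>" for f \<phi> n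
    unfolding S_def by (intro cSUP_upper bdd that) simp
  have S_least: "S \<phi> f \<le> c" if "\<And>n. apply_bcontfun f n + \<phi> n \<le> c" for f \<phi> c
    unfolding S_def using that by (intro cSUP_least) auto
  \<comment> \<open>This is where \<open>nonneg\<close> enters: it keeps the infimum defining
    \<open>q\<close> from being unbounded below.\<close>
  have S_lower: "- norm f \<le> S \<phi> f" if \<phi>: "\<phi> \<in> \<Phi>" for f \<phi>
  proof -
    have "\<phi> n \<le> S \<phi> f + norm f" for n
      using S_upper[OF \<phi>, of f n] norm_bounded[of f n] by simp
    from nonneg[OF \<phi> this] show ?thesis by simp
  qed
  have bddS: "bdd_below ((\<lambda>\<phi>. S \<phi> f) ` \<Phi>)" for f
    using S_lower by (intro bdd_belowI2)
  have "sublinear q"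
    unfolding q_def
  proof (rule sublinear_INF[OF ne bddS])
    fix \<phi> \<psi> f g assume *: "\<phi> \<in> \<Phi>" "\<psi> \<in> \<Phi>"
    then obtain \<theta> where \<theta>: "\<theta> \<in> \<Phi>" "\<And>n. \<theta> n \<le> \<phi> n + \<psi> n" using add by blast
    have "S \<theta> (f + g) \<le> S \<phi> f + S \<psi> g"
    proof (rule S_least)
      fix n show "apply_bcontfun (f + g) n + \<theta> n \<le> S \<phi> f + S \<psi> g"
        using S_upper[OF *(1), of f n] S_upper[OF *(2), of g n] \<theta>(2)[of n] by simp
    qed
    then show "\<exists>\<theta>\<in>\<Phi>. S \<theta> (f + g) \<le> S \<phi> f + S \<psi> g" using \<theta>(1) by blast
  next
    fix \<phi> f and c :: real assume *: "\<phi> \<in> \<Phi>" "0 < c"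
    then obtain \<theta> where \<theta>: "\<theta> \<in> \<Phi>" "\<And>n. \<theta> n \<le> c * \<phi> n" using scale by blast
    have "S \<theta> (c *\<^sub>R f) \<le> c * S \<phi> f"
    proof (rule S_least)
      fix n show "apply_bcontfun (c *\<^sub>R f) n + \<theta> n \<le> c * S \<phi> f"
        using mult_left_mono[OF S_upper[OF *(1), of f n], of c] *(2) \<theta>(2)[of n]
        by (simp add: algebra_simps)
    qed
    then show "\<exists>\<theta>\<in>\<Phi>. S \<theta> (c *\<^sub>R f) \<le> c * S \<phi> f" using \<theta>(1) by blast
  qed
  then obtain L where L: "linear L" and Lq: "\<And>f. L f \<le> q f"
    using sublinear_dominates_linear by blast
  have LS: "L f \<le> S \<phi> f" if "\<phi> \<in> \<Phi>" for f \<phi>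
    using Lq[of f] cINF_lower[OF bddS that, of f] by (simp add: q_def)
  \<comment> \<open>With \<open>K\<close> bounding \<phi>, the factor \<open>\<epsilon> / K\<close>
    yields a member of the cone that is at most \<epsilon> everywhere.\<close>
  have L_le: "L f \<le> c" if f: "\<And>n. apply_bcontfun f n \<le> c" for f c
  proof (rule field_le_epsilon)
    fix \<epsilon> :: real assume \<epsilon>: "0 < \<epsilon>"
    obtain \<phi> where \<phi>: "\<phi> \<in> \<Phi>" using ne by blast
    obtain K where K: "0 < K" "\<And>n. norm (\<phi> n) \<le> K"
      using convergent_range_bounded[OF conv[OF \<phi>]] by (auto simp: bounded_pos)
    obtain \<theta> where \<theta>: "\<theta> \<in> \<Phi>" "\<And>n. \<theta> n \<le> \<epsilon> / K * \<phi> n"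
      using scale[OF \<phi>, of "\<epsilon> / K"] \<epsilon> K by auto
    have "S \<theta> f \<le> c + \<epsilon>"
    proof (rule S_least)
      fix n
      have "\<epsilon> / K * \<phi> n \<le> \<epsilon> / K * K"
        using K(2)[of n] K(1) \<epsilon> by (intro mult_left_mono) auto
      then show "apply_bcontfun f n + \<theta> n \<le> c + \<epsilon>"
        using \<theta>(2)[of n] f[of n] K(1) by simp
    qed
    then show "L f \<le> c + \<epsilon>" using LS[OF \<theta>(1), of f] by simp
  qed
  obtain b :: real and a :: "nat \<Rightarrow> real" where ba: "0 \<le> b" "\<And>n. 0 \<le> a n" "summable a" "b + (\<Sum>n. a n) = 1"
    and rep: "\<And>f l. apply_bcontfun f \<longlonglongrightarrow> l \<Longrightarrow>
         summable (\<lambda>n. a n * f n) \<and> L f = b * l + (\<Sum>n. a n * f n)"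
    using linear_le_SUP_weights[OF L L_le] by blast
  have "summable (\<lambda>n. a n * \<phi> n) \<and> 0 \<le> b * lim \<phi> + (\<Sum>n. a n * \<phi> n)" if \<phi>: "\<phi> \<in> \<Phi>" for \<phi>
  proof -
    define f where "f = Bcontfun \<phi>"
    have f: "apply_bcontfun f = \<phi>"
      by (simp add: f_def Bcontfun_inverse convergent_in_bcontfun conv \<phi>)
    \<comment> \<open>Here \<open>f\<close> is \<phi> itself, so \<open>- f + \<phi>\<close> is the
      zero sequence.\<close>
    have "L (- f) \<le> 0"
      using LS[OF \<phi>, of "- f"] S_least[of "- f" \<phi> 0] by (simp add: f)
    then have "0 \<le> L f" by (simp add: linear_neg[OF L])
    then show ?thesis
      using rep[of f "lim \<phi>"] conv[OF \<phi>] by (simp add: f convergent_LIMSEQ_iff)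
  qed
  then show ?thesis using that ba by blast
qed

section \<open>Dini derivatives\<close>

lemma open_ext_ball: "open (ext_ball z r)"
  unfolding ext_ball_def by (intro open_Collect_less continuous_intros)

lemma center_in_ext_ball: "0 < r \<Longrightarrow> z \<in> ext_ball z r"
  by (simp add: ext_ball_def zero_ereal_def)

lemma lip_norm_leD:
  assumes "lip_norm S f \<le> ennreal c" and "0 \<le> c" and "x \<in> S" and "y \<in> S"
  shows "\<bar>f x - f y\<bar> \<le> c * norm (x - y)"
proof (cases "x = y")
  case False
  have "ennreal (\<bar>f x - f y\<bar> / norm (x - y)) \<le> lip_norm S f"
    unfolding lip_norm_def using assms(3,4) False by (intro SUP_upper2[of "(x, y)"]) auto
  then have "\<bar>f x - f y\<bar> / norm (x - y) \<le> c"
    using assms(1,2) by (simp add: ennreal_le_iff[symmetric] del: ennreal_le_iff)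
  then show ?thesis using False by (simp add: field_simps)
qed simp

lemma dini_upper_less_eventually:
  assumes "dini_upper f z u = ereal p" and "p < c"
  shows "\<forall>\<^sub>F t in at_right 0. f (z + t *\<^sub>R u) < f z + t * c"
proof -
  have "\<forall>\<^sub>F t in at_right 0. ereal ((f (z + t *\<^sub>R u) - f z) / t) < ereal c"
    using assms by (intro Limsup_lessD) (simp add: dini_upper_def)
  with eventually_at_right_less[of 0] show ?thesis
    by eventually_elim (simp add: field_simps)
qed

lemma dini_upper_le_of_eventually:
  assumes "dini_upper f z u = ereal p"
    and "\<forall>\<^sub>F t in at_right 0. f (z + t *\<^sub>R u) \<le> f z + t * c"
  shows "p \<le> c"
proof -
  have "\<forall>\<^sub>F t in at_right 0. ereal ((f (z + t *\<^sub>R u) - f z) / t) \<le> ereal c"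
    using assms(2) eventually_at_right_less[of 0] by eventually_elim (simp add: field_simps)
  then have "ereal p \<le> ereal c" unfolding assms(1)[symmetric] dini_upper_def by (rule Limsup_bounded)
  then show ?thesis by simp
qed

lemma eventually_segment_in_open:
  fixes z :: "'a::real_normed_vector"
  assumes "open U" and "z \<in> U"
  shows "\<forall>\<^sub>F t in at_right (0::real). z + t *\<^sub>R u \<in> U"
proof -
  have "((\<lambda>t. z + t *\<^sub>R u) \<longlongrightarrow> z + 0 *\<^sub>R u) (at_right 0)" by (intro tendsto_intros)
  then show ?thesis using assms by (intro topological_tendstoD) auto
qed

text \<open>At \<open>x = z + t *\<^sub>R u\<close> the norm of \<open>x - z\<close> is
  \<open>t * norm u\<close>, so the increments differ in slope by at most \<open>c * norm u\<close>.
  The slack \<open>e\<close> comes from the strict bound below a limit superior.\<close>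

lemma dini_upper_le_add:
  assumes "open U" and "z \<in> U"
    and le: "\<And>x. x \<in> U \<Longrightarrow> (f x - f z) - (g x - g z) \<le> c * norm (x - z)"
    and f: "dini_upper f z u = ereal p" and g: "dini_upper g z u = ereal q"
  shows "p \<le> q + c * norm u"
proof (rule field_le_epsilon)
  fix e :: real assume e: "0 < e"
  have "\<forall>\<^sub>F t in at_right 0. f (z + t *\<^sub>R u) \<le> f z + t * (q + c * norm u + e)"
    using eventually_segment_in_open[OF assms(1,2), of u] eventually_at_right_less[of 0]
      dini_upper_less_eventually[OF g less_add_same_cancel1[THEN iffD2, OF e]]
  proof eventually_elim
    case (elim t)
    show ?case using le[OF elim(1)] elim(2,3) by (simp add: algebra_simps)
  qed
  then show "p \<le> q + c * norm u + e" by (rule dini_upper_le_of_eventually[OF f])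
qed

lemma eventually_all_le_nat:
  assumes "\<And>n. n \<le> N \<Longrightarrow> eventually (P n) F"
  shows "eventually (\<lambda>t. \<forall>n\<le>(N::nat). P n t) F"
  using eventually_ball_finite[of "{..N}" "\<lambda>t n. P n t" F] assms by (simp add: Ball_def)

section \<open>Uniform Dini estimates for sequences converging in the Lipschitz seminorm\<close>

locale dini_sequence =
  fixes U :: "'a::real_normed_vector set" and h :: "nat \<Rightarrow> 'a \<Rightarrow> real" and hinf :: "'a \<Rightarrow> real"
    and z :: 'a and p :: "nat \<Rightarrow> 'a \<Rightarrow> real"
  assumes U: "open U" "z \<in> U"
    and dini: "\<And>n u. dini_upper (h n) z u = ereal (p n u)"
    and lim: "(\<lambda>n. h n z) \<longlonglongrightarrow> hinf z"
    and lip: "(\<lambda>n. lip_norm U (\<lambda>x. h n x - hinf x)) \<longlonglongrightarrow> 0"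
begin

lemma lip_eventually:
  assumes "0 < e"
  shows "\<exists>N. \<forall>n\<ge>N. \<forall>x\<in>U. \<bar>(h n x - h n z) - (hinf x - hinf z)\<bar> \<le> e * norm (x - z)"
proof -
  have "\<forall>\<^sub>F n in sequentially. lip_norm U (\<lambda>x. h n x - hinf x) < ennreal e"
    using assms by (intro order_tendstoD(2)[OF lip]) simp
  then obtain N where N: "\<And>n. n \<ge> N \<Longrightarrow> lip_norm U (\<lambda>x. h n x - hinf x) < ennreal e"
    by (auto simp: eventually_sequentially)
  show ?thesis
  proof (intro exI allI impI ballI)
    fix n x assume "n \<ge> N" "x \<in> U"
    then show "\<bar>(h n x - h n z) - (hinf x - hinf z)\<bar> \<le> e * norm (x - z)"
      using lip_norm_leD[OF less_imp_le[OF N], of n x z] assms U(2) by (simp add: algebra_simps)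
  qed
qed

text \<open>Comparing two late members through \<open>hinf\<close> eliminates \<open>hinf\<close>,
  whose Dini derivative is not controlled.\<close>

lemma increments_close:
  assumes "0 < e"
  shows "\<exists>N. \<forall>m\<ge>N. \<forall>n\<ge>N. \<forall>x\<in>U. (h m x - h m z) - (h n x - h n z) \<le> e * norm (x - z)"
proof -
  obtain N where N: "\<And>n x. n \<ge> N \<Longrightarrow> x \<in> U \<Longrightarrow>
      \<bar>(h n x - h n z) - (hinf x - hinf z)\<bar> \<le> e / 2 * norm (x - z)"
    using lip_eventually[of "e / 2"] assms by auto
  have "(h m x - h m z) - (h n x - h n z) \<le> e * norm (x - z)"
    if "m \<ge> N" "n \<ge> N" "x \<in> U" for m n x
    using N[OF that(1,3)] N[OF that(2,3)] unfolding abs_le_iff by (simp add: field_simps)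
  then show ?thesis by blast
qed

lemma h_tendsto:
  assumes "x \<in> U"
  shows "(\<lambda>n. h n x) \<longlonglongrightarrow> hinf x"
proof -
  have "(\<lambda>n. (h n x - h n z) - (hinf x - hinf z)) \<longlonglongrightarrow> 0"
  proof (rule LIMSEQ_I)
    fix r :: real assume r: "0 < r"
    \<comment> \<open>The added \<open>1\<close> keeps \<open>e\<close> positive when
      \<open>x = z\<close> and makes the resulting bound strict.\<close>
    define e where "e = r / (norm (x - z) + 1)"
    have pos: "0 < norm (x - z) + 1" by (simp add: add_nonneg_pos)
    then have e: "0 < e" "e * norm (x - z) < r"
      using r by (simp_all add: e_def divide_simps)
    obtain N where "\<forall>n\<ge>N. \<forall>x\<in>U. \<bar>(h n x - h n z) - (hinf x - hinf z)\<bar> \<le> e * norm (x - z)"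
      using lip_eventually[OF e(1)] by blast
    then show "\<exists>N. \<forall>n\<ge>N. norm ((h n x - h n z) - (hinf x - hinf z) - 0) < r"
      using assms e(2) by (intro exI[of _ N]) (force intro: le_less_trans)
  qed
  from tendsto_add[OF tendsto_add[OF this lim] tendsto_const[of "hinf x - hinf z"]]
  show ?thesis by simp
qed

text \<open>Close increments give close derivatives, in both orders of the two indices, so the
  sequence is Cauchy; its limit is not identified with a derivative of \<open>hinf\<close>.\<close>

lemma p_convergent: "convergent (\<lambda>n. p n u)"
proof (rule real_Cauchy_convergent, rule metric_CauchyI)
  fix r :: real assume r: "0 < r"
  define e where "e = r / (norm u + 1)"
  have pos: "0 < norm u + 1" by (simp add: add_nonneg_pos)
  then have e: "0 < e" "e * norm u < r"
    using r by (simp_all add: e_def divide_simps)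
  obtain N where N: "\<forall>m\<ge>N. \<forall>n\<ge>N. \<forall>x\<in>U. (h m x - h m z) - (h n x - h n z) \<le> e * norm (x - z)"
    using increments_close[OF e(1)] by blast
  have "p m u \<le> p n u + e * norm u" if "m \<ge> N" "n \<ge> N" for m n
    using N that by (intro dini_upper_le_add[OF U _ dini dini]) auto
  then show "\<exists>N. \<forall>m\<ge>N. \<forall>n\<ge>N. dist (p m u) (p n u) < r"
    using e(2) by (intro exI[of _ N]) (smt (verit) dist_real_def)
qed

text \<open>Uniformity in \<open>n\<close>: beyond some \<open>N\<close> all increments and all derivatives are close to those
  of \<open>h N\<close>, so that finitely many indices remain.\<close>

lemma dini_uniform:
  assumes e: "0 < e"
  shows "\<forall>\<^sub>F t in at_right 0. \<forall>n. h n (z + t *\<^sub>R u) \<le> h n z + t * (p n u + e)"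
proof -
  \<comment> \<open>The error \<open>e\<close> is split into \<open>d\<close> for the Dini estimate
    of \<open>h N\<close>, \<open>d * norm u\<close> for replacing \<open>h n\<close> by
    \<open>h N\<close>, and \<open>d * norm u\<close> for returning from \<open>p N\<close> to
    \<open>p n\<close>.\<close>
  define d where "d = e / (2 * norm u + 1)"
  have pos: "0 < 2 * norm u + 1" by (simp add: add_nonneg_pos)
  have d: "0 < d" "d * (2 * norm u + 1) = e"
    using pos e by (simp_all add: d_def)
  obtain N where N: "\<And>m n x. m \<ge> N \<Longrightarrow> n \<ge> N \<Longrightarrow> x \<in> U \<Longrightarrow>
      (h m x - h m z) - (h n x - h n z) \<le> d * norm (x - z)"
    using increments_close[OF d(1)] by blast
  have pN: "p N u \<le> p n u + d * norm u" if "n \<ge> N" for n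
    using N that by (intro dini_upper_le_add[OF U _ dini dini]) auto
  have de: "d \<le> e" using d by (smt (verit) mult_left_mono norm_ge_zero mult_cancel_left1)
  have "\<forall>\<^sub>F t in at_right 0. \<forall>n\<le>N. h n (z + t *\<^sub>R u) < h n z + t * (p n u + d)"
    using d(1) by (intro eventually_all_le_nat dini_upper_less_eventually[OF dini]) simp
  with eventually_segment_in_open[OF U, of u] eventually_at_right_less[of 0] show ?thesis
  proof eventually_elim
    case (elim t)
    show ?case
    proof
      fix n
      show "h n (z + t *\<^sub>R u) \<le> h n z + t * (p n u + e)"
      proof (cases "n \<le> N")
        case True
        have "t * (p n u + d) \<le> t * (p n u + e)"
          using de elim(2) by (intro mult_left_mono) auto
        then show ?thesis using elim(3) True by force
      next
        case False
        have "h n (z + t *\<^sub>R u) - h n z \<le> (h N (z + t *\<^sub>R u) - h N z) + t * (d * norm u)"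
          using N[of n N "z + t *\<^sub>R u"] False elim by (simp add: algebra_simps)
        also have "\<dots> \<le> t * (p N u + d) + t * (d * norm u)"
          using elim(3)[rule_format, of N] by simp
        also have "\<dots> = t * (p N u + d + d * norm u)" by (simp add: algebra_simps)
        also have "\<dots> \<le> t * (p n u + e)"
          using pN[of n] False elim(2) d(2) by (intro mult_left_mono) (auto simp: algebra_simps)
        finally show ?thesis by simp
      qed
    qed
  qed
qed

text \<open>With slack \<open>- c / 2\<close> in \<open>dini_uniform\<close>, a small step
  \<open>t\<close> along \<open>u\<close>, paired with the parameter \<open>t * \<tau>\<close>,
  makes every difference at most \<open>t * c / 2\<close>. This bound does not depend on
  \<open>n\<close>, so the supremum stays strictly negative.\<close>

lemma descent_point:
  assumes V: "open V" "z \<in> V" and \<tau>: "0 \<le> \<tau>" and c: "c < 0"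
    and le: "\<And>n. \<tau> * h n z + p n u \<le> c"
  shows "\<exists>x\<in>V. \<exists>t\<in>{0..1}. (SUP n. ereal (h n x - (1 - t) * h n z)) < 0"
proof -
  have "\<forall>\<^sub>F t in at_right 0. t * \<tau> < 1"
  proof (rule order_tendstoD(2))
    show "((\<lambda>t. t * \<tau>) \<longlongrightarrow> 0 * \<tau>) (at_right 0)" by (intro tendsto_intros)
  qed simp
  moreover have "\<forall>\<^sub>F t in at_right 0. \<forall>n. h n (z + t *\<^sub>R u) \<le> h n z + t * (p n u - c / 2)"
    using dini_uniform[of "- c / 2" u] c by simp
  ultimately have "\<forall>\<^sub>F t in at_right 0. 0 < t \<and> t * \<tau> < 1 \<and> z + t *\<^sub>R u \<in> V \<and>
      (\<forall>n. h n (z + t *\<^sub>R u) \<le> h n z + t * (p n u - c / 2))"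
    using eventually_segment_in_open[OF V, of u] eventually_at_right_less[of 0]
    by eventually_elim simp
  then obtain t where t: "0 < t" "t * \<tau> < 1" "z + t *\<^sub>R u \<in> V"
    and ht: "\<And>n. h n (z + t *\<^sub>R u) \<le> h n z + t * (p n u - c / 2)"
    using eventually_happens'[OF trivial_limit_at_right_real] by blast
  have "h n (z + t *\<^sub>R u) - (1 - t * \<tau>) * h n z \<le> t * c / 2" for n
    using ht[of n] mult_left_mono[OF le[of n], of t] t(1) by (simp add: algebra_simps)
  then have "(SUP n. ereal (h n (z + t *\<^sub>R u) - (1 - t * \<tau>) * h n z)) \<le> ereal (t * c / 2)"
    by (intro SUP_least) simp
  also have "\<dots> < 0" using t(1) c by (simp add: mult_pos_neg zero_ereal_def)
  finally show ?thesis using t \<tau> by (intro bexI[of _ "z + t *\<^sub>R u"] bexI[of _ "t * \<tau>"]) auto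
qed

end

section \<open>Extended-real series and the final alternative\<close>

text \<open>The series of \<open>f - g\<close> has nonnegative terms, so it has a value in the
  extended reals, and adding the finite sum of \<open>g\<close> is never indeterminate. This handles
  points off the ball, where \<open>h n x\<close> may be unbounded above.\<close>

lemma suminf_ereal_ge:
  fixes f g :: "nat \<Rightarrow> real"
  assumes "summable g" and "\<And>n. g n \<le> f n"
  shows "summable (\<lambda>n. ereal (f n))" "ereal (\<Sum>n. g n) \<le> (\<Sum>n. ereal (f n))"
proof -
  define S where "S = (\<Sum>n. ereal (f n - g n))"
  have S0: "0 \<le> S"
    unfolding S_def using assms(2) by (intro suminf_0_le summable_ereal_pos) auto
  have "(\<lambda>n. ereal (f n - g n)) sums S"
    unfolding S_def using assms(2) by (intro summable_sums summable_ereal_pos) auto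
  moreover have "(\<lambda>n. ereal (g n)) sums ereal (\<Sum>n. g n)"
    using summable_sums[OF assms(1)] by (simp add: sums_ereal)
  ultimately have "(\<lambda>N. (\<Sum>n<N. ereal (f n - g n)) + (\<Sum>n<N. ereal (g n)))
      \<longlonglongrightarrow> S + ereal (\<Sum>n. g n)"
    unfolding sums_def using S0 by (intro tendsto_add_ereal_general) auto
  then have "(\<lambda>n. ereal (f n)) sums (S + ereal (\<Sum>n. g n))"
    unfolding sums_def sum.distrib[symmetric] by simp
  then show "summable (\<lambda>n. ereal (f n))" "ereal (\<Sum>n. g n) \<le> (\<Sum>n. ereal (f n))"
    using add_right_mono[OF S0, of "ereal (\<Sum>n. g n)"] by (auto simp: sums_iff)
qed

theorem corollary1:
  fixes \<Omega> :: "'a::real_normed_vector set"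
    and h :: "nat \<Rightarrow> 'a \<Rightarrow> real"
    and hinf :: "'a \<Rightarrow> real"
    and z :: 'a
    and r :: ereal
  assumes "open \<Omega>" and "z \<in> \<Omega>"
    and "property_H \<Omega> h z r hinf"
    and "invex_seq \<Omega> h z"
  shows
    "{(x, t). x \<in> \<Omega> \<and> t \<in> {0..1::real} \<and>
        (SUP n. ereal (h n x - (1 - t) * h n z)) < 0} \<noteq> {} \<or>
     (\<exists>(ainf::real) (a::nat \<Rightarrow> real).
        (0 \<le> ainf \<and> (\<forall>n. 0 \<le> a n) \<and> summable a \<and> ainf + (\<Sum>n. a n) = 1) \<and>
        (summable (\<lambda>n. a n * h n z) \<and> 0 \<le> ainf * hinf z + (\<Sum>n. a n * h n z)) \<and>
        (\<forall>x\<in>\<Omega>. summable (\<lambda>n. ereal (a n * h n x)) \<and> - \<infinity> < (\<Sum>n. ereal (a n * h n x)) \<and>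
          weighted_fun ainf a (limit_fun (ext_ball z r) h hinf) h z
            \<le> weighted_fun ainf a (limit_fun (ext_ball z r) h hinf) h x))"
proof -
  define B where "B = ext_ball z r"
  have H: "0 < r" "(\<lambda>n. h n z) \<longlonglongrightarrow> hinf z"
    "(\<lambda>n. lip_norm (B \<inter> \<Omega>) (\<lambda>x. h n x - hinf x)) \<longlonglongrightarrow> 0"
    using assms(3) by (auto simp: property_H_def B_def)
  obtain p where p: "\<And>n. sublinear (p n)" "\<And>n u. dini_upper (h n) z u = ereal (p n u)"
    using assms(3) unfolding property_H_def by metis
  have zB: "z \<in> B" using H(1) by (simp add: B_def center_in_ext_ball)
  interpret dini_sequence "B \<inter> \<Omega>" h hinf z p
    using assms(1,2) zB H p(2) by unfold_locales (auto simp: B_def open_ext_ball)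
  obtain \<mu> where \<mu>: "\<And>x n. x \<in> \<Omega> \<Longrightarrow> p n (\<mu> x) \<le> h n x - h n z"
    using assms(4) unfolding invex_seq_def p(2) ereal_less_eq by blast
  \<comment> \<open>To first order this is the slope at \<open>t = 0\<close> of
    \<open>h n (z + t *\<^sub>R u) - (1 - t * \<tau>) * h n z\<close>, the quantity of the first
    alternative.\<close>
  define \<phi> where "\<phi> u \<tau> n = \<tau> * h n z + p n u" for u \<tau> n
  define \<Phi> where "\<Phi> = {\<phi> u \<tau> | u \<tau>. 0 \<le> \<tau>}"
  show ?thesis
  proof (cases "\<exists>x\<in>\<Omega>. \<exists>t\<in>{0..1}. (SUP n. ereal (h n x - (1 - t) * h n z)) < 0")
    case True
    then show ?thesis by blast
  next
    case no_descent: False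
    have \<phi>_lim: "\<phi> u \<tau> \<longlonglongrightarrow> \<tau> * hinf z + lim (\<lambda>n. p n u)" for u \<tau>
      unfolding \<phi>_def using p_convergent[of u] lim
      by (intro tendsto_intros) (auto simp: convergent_LIMSEQ_iff)
    obtain b a where b: "0 \<le> b" and a: "\<And>n. 0 \<le> a n" "summable a" and ba: "b + (\<Sum>n. a n) = 1"
      and pos: "\<And>\<psi>. \<psi> \<in> \<Phi> \<Longrightarrow> summable (\<lambda>n. a n * \<psi> n) \<and> 0 \<le> b * lim \<psi> + (\<Sum>n. a n * \<psi> n)"
    proof (rule cone_separating_weights[of \<Phi>])
      show "\<Phi> \<noteq> {}" by (auto simp: \<Phi>_def)
    next
      fix \<psi> assume "\<psi> \<in> \<Phi>"
      then show "convergent \<psi>" using \<phi>_lim by (auto simp: \<Phi>_def convergent_def)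
    next
      fix \<psi> \<theta> assume "\<psi> \<in> \<Phi>" "\<theta> \<in> \<Phi>"
      then obtain u \<tau> v \<sigma> where *: "\<psi> = \<phi> u \<tau>" "0 \<le> \<tau>" "\<theta> = \<phi> v \<sigma>" "0 \<le> \<sigma>"
        by (auto simp: \<Phi>_def)
      have "\<phi> (u + v) (\<tau> + \<sigma>) n \<le> \<psi> n + \<theta> n" for n
        using sublinear_add_le[OF p(1), of n u v] by (simp add: * \<phi>_def algebra_simps)
      moreover have "\<phi> (u + v) (\<tau> + \<sigma>) \<in> \<Phi>"
        using * unfolding \<Phi>_def by (blast intro: add_nonneg_nonneg)
      ultimately show "\<exists>\<upsilon>\<in>\<Phi>. \<forall>n. \<upsilon> n \<le> \<psi> n + \<theta> n" by blast
    next
      fix \<psi> and c :: real assume "\<psi> \<in> \<Phi>" and c: "0 < c"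
      then obtain u \<tau> where *: "\<psi> = \<phi> u \<tau>" "0 \<le> \<tau>" by (auto simp: \<Phi>_def)
      have "\<phi> (c *\<^sub>R u) (c * \<tau>) n \<le> c * \<psi> n" for n
        using c by (simp add: * \<phi>_def sublinear_scaleR[OF p(1)] algebra_simps)
      moreover have "\<phi> (c *\<^sub>R u) (c * \<tau>) \<in> \<Phi>"
        using * c unfolding \<Phi>_def by (blast intro: mult_nonneg_nonneg less_imp_le)
      ultimately show "\<exists>\<upsilon>\<in>\<Phi>. \<forall>n. \<upsilon> n \<le> c * \<psi> n" by blast
    next
      fix \<psi> and c :: real assume "\<psi> \<in> \<Phi>" and c: "\<And>n. \<psi> n \<le> c"
      then obtain u \<tau> where *: "\<psi> = \<phi> u \<tau>" "0 \<le> \<tau>" by (auto simp: \<Phi>_def)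
      show "0 \<le> c"
      proof (rule ccontr)
        \<comment> \<open>A negative bound uniform in \<open>n\<close> would give a point of the
          first alternative, with \<Omega> as the neighbourhood \<open>V\<close>.\<close>
        assume "\<not> 0 \<le> c"
        then show False
          using descent_point[OF assms(1,2) *(2), of c u] c no_descent by (auto simp: * \<phi>_def)
      qed
    qed (rule that)
    have pos': "summable (\<lambda>n. a n * \<phi> u \<tau> n)"
        "0 \<le> b * (\<tau> * hinf z + lim (\<lambda>n. p n u)) + (\<Sum>n. a n * \<phi> u \<tau> n)" if "0 \<le> \<tau>" for u \<tau>
      using pos[of "\<phi> u \<tau>"] that limI[OF \<phi>_lim] by (auto simp: \<Phi>_def)
    have z: "summable (\<lambda>n. a n * h n z)" "0 \<le> b * hinf z + (\<Sum>n. a n * h n z)"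
      using pos'[of 1 0] by (simp_all add: \<phi>_def sublinear_0[OF p(1)])
    have wz: "weighted_fun b a (limit_fun B h hinf) h z = ereal (b * hinf z + (\<Sum>n. a n * h n z))"
      using zB z(1) by (intro weighted_fun_real) (simp add: limit_fun_def)
    have "summable (\<lambda>n. ereal (a n * h n x)) \<and> - \<infinity> < (\<Sum>n. ereal (a n * h n x)) \<and>
        weighted_fun b a (limit_fun B h hinf) h z \<le> weighted_fun b a (limit_fun B h hinf) h x"
      if x: "x \<in> \<Omega>" for x
    proof -
      define u where "u = \<mu> x"
      define l where "l = lim (\<lambda>n. p n u)"
      \<comment> \<open>By invexity \<open>\<phi> u 1\<close> lies below \<open>h n x\<close> for
        every \<open>n\<close>; being convergent, it has a finite weighted series that bounds the
        series at \<open>x\<close> from below.\<close>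
      have le: "a n * \<phi> u 1 n \<le> a n * h n x" for n
        using \<mu>[OF x, of n] a(1)[of n] by (intro mult_left_mono) (simp_all add: \<phi>_def u_def)
      note s = suminf_ereal_ge[OF pos'(1)[OF zero_le_one] le]
      \<comment> \<open>The limit of the minorant \<open>\<phi> u 1\<close> is compared with the
        limit of \<open>h n x\<close> on the ball, and with its lower limit elsewhere.\<close>
      have "ereal (hinf z + l) \<le> limit_fun B h hinf x"
      proof (cases "x \<in> B")
        case True
        have "hinf z + l \<le> hinf x"
        proof (rule LIMSEQ_le)
          show "(\<lambda>n. h n x) \<longlonglongrightarrow> hinf x" using True x by (intro h_tendsto) simp
          show "\<phi> u 1 \<longlonglongrightarrow> hinf z + l" using \<phi>_lim[of u 1] by (simp add: l_def)
        qed (use \<mu>[OF x] in \<open>auto simp: \<phi>_def u_def algebra_simps\<close>)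
        then show ?thesis using True by (simp add: limit_fun_def)
      next
        case False
        have "(\<lambda>n. ereal (\<phi> u 1 n)) \<longlonglongrightarrow> ereal (hinf z + l)"
          using \<phi>_lim[of u 1] by (simp add: l_def)
        from lim_imp_Liminf[OF sequentially_bot this, symmetric]
        have "ereal (hinf z + l) = liminf (\<lambda>n. ereal (\<phi> u 1 n))" .
        also have "\<dots> \<le> liminf (\<lambda>n. ereal (h n x))"
          using \<mu>[OF x] by (intro Liminf_mono always_eventually) (auto simp: \<phi>_def u_def algebra_simps)
        finally show ?thesis using False by (simp add: limit_fun_def le_max_iff_disj)
      qed
      \<comment> \<open>If \<open>limit_fun\<close> is infinite at \<open>x\<close> and
        \<open>b = 0\<close>, the convention \<open>0 * \<infinity> = 0\<close> keeps this
        true.\<close>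
      then have lim_le: "ereal (b * (hinf z + l)) \<le> ereal b * limit_fun B h hinf x"
        using ereal_mult_left_mono[of _ _ "ereal b"] b by fastforce
      \<comment> \<open>Separating the value at \<open>z\<close> leaves \<open>\<phi> u 0\<close>,
        on which the functional is nonnegative by \<open>pos'\<close> with
        \<open>\<tau> = 0\<close>.\<close>
      have split: "(\<Sum>n. a n * \<phi> u 1 n) = (\<Sum>n. a n * h n z) + (\<Sum>n. a n * \<phi> u 0 n)"
        using suminf_add[OF z(1) pos'(1)[of 0 u]] by (simp add: \<phi>_def algebra_simps)
      have "b * hinf z + (\<Sum>n. a n * h n z) \<le> b * (hinf z + l) + (\<Sum>n. a n * \<phi> u 1 n)"
        using pos'(2)[of 0 u] by (simp add: split l_def algebra_simps)
      then have "ereal (b * hinf z + (\<Sum>n. a n * h n z))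
          \<le> ereal (b * (hinf z + l)) + ereal (\<Sum>n. a n * \<phi> u 1 n)" by simp
      also have "\<dots> \<le> weighted_fun b a (limit_fun B h hinf) h x"
        unfolding weighted_fun_def by (intro add_mono lim_le s(2))
      finally have "weighted_fun b a (limit_fun B h hinf) h z
          \<le> weighted_fun b a (limit_fun B h hinf) h x" by (simp only: wz)
      moreover have "- \<infinity> < (\<Sum>n. ereal (a n * h n x))"
        by (rule less_le_trans[OF _ s(2)]) simp
      ultimately show ?thesis using s(1) by (intro conjI)
    qed
    then show ?thesis
      using a b ba z unfolding B_def
      by (intro disjI2 exI[of _ b] exI[of _ a] conjI ballI allI) blast+
  qed
qed

end
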